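(* Let $\kappa\geq\omega$ be a cardinal and let $X$ be a Hausdorff space that is a continuous image of a product of compacta each of weight at most $\kappa$. Suppose $\pi\chi(p,X)=w(X)$ for all $p\in X$. Then every base of $X$ contains a subset that is a $\kappa^{\mathrm{op}}$-like base of $X$.
   Context: A compactum is a compact Hausdorff space. $\pi\chi(p,X)$ is the $\pi$-character of $p$ and $w(X)$ the weight. Families of open sets are ordered by inclusion; a family is $\kappa^{\mathrm{op}}$-like if no member is contained in $\kappa$-many members. *)

theory Defs
  imports "HOL-Analysis.Analysis"
begin

unbundle cardinal_syntax

definition is_base :: "'a topology \<Rightarrow> 'a set set \<Rightarrow> bool" where
  "is_base X \<B> \<longleftrightarrow> (\<forall>V\<in>\<B>. openin X V) \<and>
     (\<forall>U x. openin X U \<and> x \<in> U \<longrightarrow> (\<exists>V\<in>\<B>. x \<in> V \<and> V \<subseteq> U))"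

definition is_local_pi_base :: "'a topology \<Rightarrow> 'a \<Rightarrow> 'a set set \<Rightarrow> bool" where
  "is_local_pi_base X p \<P> \<longleftrightarrow> (\<forall>V\<in>\<P>. openin X V \<and> V \<noteq> {}) \<and>
     (\<forall>U. openin X U \<and> p \<in> U \<longrightarrow> (\<exists>V\<in>\<P>. V \<subseteq> U))"

definition realizes_weight :: "'a topology \<Rightarrow> 'a set set \<Rightarrow> bool" where
  "realizes_weight X \<B> \<longleftrightarrow> is_base X \<B> \<and>
     (\<forall>\<B>2. is_base X \<B>2 \<longrightarrow> (card_of \<B>) \<le>o (card_of \<B>2))"

definition realizes_pi_char :: "'a topology \<Rightarrow> 'a \<Rightarrow> 'a set set \<Rightarrow> bool" where
  "realizes_pi_char X p \<P> \<longleftrightarrow> is_local_pi_base X p \<P> \<and>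
     (\<forall>\<P>2. is_local_pi_base X p \<P>2 \<longrightarrow> (card_of \<P>) \<le>o (card_of \<P>2))"

definition pi_char_eq_weight :: "'a topology \<Rightarrow> 'a \<Rightarrow> bool" where
  "pi_char_eq_weight X p \<longleftrightarrow>
     (\<exists>\<P> \<B>. realizes_pi_char X p \<P> \<and> realizes_weight X \<B> \<and> (card_of \<P>) =o (card_of \<B>))"

definition weight_le :: "'a topology \<Rightarrow> 'k set \<Rightarrow> bool" where
  "weight_le X K \<longleftrightarrow> (\<exists>\<B>. is_base X \<B> \<and> (card_of \<B>) \<le>o (card_of K))"

definition op_like :: "'k set \<Rightarrow> 'a set set \<Rightarrow> bool" where
  "op_like K \<F> \<longleftrightarrow> (\<forall>A\<in>\<F>. (card_of {B\<in>\<F>. A \<subseteq> B}) <o (card_of K))"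

end

theory Submission
  imports Defs
begin

text \<open>Let \<open>\<lambda>\<close> be the weight of \<open>X\<close>. Refine pairs \<open>(U\<^sub>0, U\<^sub>1)\<close> of a base of size \<open>\<lambda>\<close> with
  \<open>cl U\<^sub>0 \<subseteq> U\<^sub>1\<close> one after the other, in order type \<open>\<lambda>\<close>, by finitely many members \<open>U\<close> of the given
  base, and enclose the preimage of each \<open>U\<close> in a finite union \<open>g\<close> of basic boxes of the product.

  The key is reflection: let \<open>J\<close> be a set of coordinates and \<open>V\<close> nonempty open in \<open>X\<close>. Between the
  preimages of a smaller nonempty open set and of \<open>V\<close> there is a finite union of nonempty boxes;
  dropping the coordinates outside \<open>J\<close> gives a finite union \<open>b\<close> of boxes over \<open>J\<close> such that every
  \<open>g\<close> supported in \<open>J\<close> that contains the preimage of \<open>V\<close> contains \<open>b\<close>. Since \<open>b\<close> contains the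
  preimage of a nonempty open set, fix such a set \<open>core b\<close>, depending on \<open>b\<close> only.

  At each stage any family of fewer than \<open>\<lambda>\<close> cores can be avoided, because the \<open>\<pi>\<close>-character is \<open>\<lambda>\<close> at every
  point. If \<open>\<lambda> > \<kappa>\<close>, avoid the cores of all \<open>b\<close> over the coordinates used so far; by
  well-founded induction each \<open>V\<close> then lies in only finitely many chosen sets. If \<open>\<lambda> = \<kappa>\<close>, avoid at
  stage \<open>t\<close> only those \<open>b\<close> that moreover are built from the first \<open>t\<close> basic open sets of each factor;
  then all \<open>U\<close> containing \<open>V\<close> are chosen before some stage \<open>t < \<kappa>\<close>. If \<open>\<lambda> < \<kappa>\<close>, nothing has to be
  avoided.\<close>

section \<open>Cardinal arithmetic\<close>

lemma finite_card_less_infinite: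
  assumes "finite A" "infinite B" shows "|A| <o |B|"
  by (rule finite_ordLess_infinite[OF card_of_Well_order card_of_Well_order])
    (use assms in \<open>simp_all add: Field_card_of\<close>)

text \<open>Finiteness of the pieces makes the union finite or of size at most \<open>|S|\<close>,
  so the bound holds for singular \<open>|T|\<close> as well.\<close>

lemma card_UN_finite_less:
  assumes "infinite T" "|S| <o |T|" "\<And>s. s \<in> S \<Longrightarrow> finite (F s)"
  shows "|\<Union>s\<in>S. F s| <o |T|"
proof (cases "finite S")
  case True
  then show ?thesis using assms by (intro finite_card_less_infinite) auto
next
  case False
  then have "|\<Union>s\<in>S. F s| \<le>o |S|"
    using assms by (intro card_of_UNION_ordLeq_infinite card_of_mono1 ballI)
      (auto intro: ordLess_imp_ordLeq finite_card_less_infinite)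
  then show ?thesis using assms(2) ordLeq_ordLess_trans by blast
qed

lemma card_Times_less:
  assumes "infinite T" "|A| <o |T|" "|B| <o |T|" shows "|A \<times> B| <o |T|"
proof (cases "finite (A <+> B)")
  case True
  then have "finite A" "finite B" by auto
  then show ?thesis using assms(1) by (intro finite_card_less_infinite) auto
next
  case False
  let ?h = "\<lambda>(x, y). (Inl x, Inr y)"
  have "|A \<times> B| \<le>o |(A <+> B) \<times> (A <+> B)|"
    by (rule card_of_ordLeqI[of ?h]) (auto simp: inj_on_def)
  also have "|(A <+> B) \<times> (A <+> B)| =o |A <+> B|" using False by (rule card_of_Times_same_infinite)
  also have "|A <+> B| <o |T|" using assms by (rule card_of_Plus_ordLess_infinite)
  finally show ?thesis .
qed

lemma subset_Times_iff: "R \<subseteq> A \<times> B \<longleftrightarrow> fst ` R \<subseteq> A \<and> snd ` R \<subseteq> B"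
  by (auto simp: subset_iff mem_Times_iff)

lemma Fpow_Fpow_iff: "g \<in> Fpow (Fpow D) \<longleftrightarrow> finite g \<and> (\<forall>a\<in>g. finite a) \<and> \<Union>g \<subseteq> D"
  unfolding Fpow_def by blast

text \<open>Sort by size: a set with \<open>n + 1\<close> elements is a point of \<open>D\<close>
  joined to a set with \<open>n\<close> elements, so each of the countably many classes has size at
  most \<open>|D|\<close>.\<close>

lemma card_Fpow_infinite:
  assumes "infinite D" shows "|Fpow D| \<le>o |D|"
proof -
  define F where "F n = {X. X \<subseteq> D \<and> finite X \<and> card X = n}" for n
  have F: "|F n| \<le>o |D|" for n
  proof (induction n)
    case 0
    have "F 0 \<subseteq> {{}}" unfolding F_def by auto
    then have "finite (F 0)" using finite_subset by blast
    then show ?case by (rule ordLess_imp_ordLeq[OF finite_card_less_infinite[OF _ assms]])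
  next
    case (Suc n)
    have "F (Suc n) \<subseteq> (\<lambda>(x, X). insert x X) ` (D \<times> F n)"
    proof
      fix X assume "X \<in> F (Suc n)"
      then have X: "X \<subseteq> D" "finite X" "card X = Suc n" unfolding F_def by auto
      then obtain x where x: "x \<in> X" by fastforce
      then have "X = insert x (X - {x})" "X - {x} \<in> F n" "x \<in> D"
        using X unfolding F_def by auto
      then show "X \<in> (\<lambda>(x, X). insert x X) ` (D \<times> F n)" by (auto intro!: image_eqI[of _ _ "(x, X - {x})"])
    qed
    then have "|F (Suc n)| \<le>o |(\<lambda>(x, X). insert x X) ` (D \<times> F n)|" by (rule card_of_mono1)
    also have "|(\<lambda>(x, X). insert x X) ` (D \<times> F n)| \<le>o |D \<times> F n|" by (rule card_of_image)
    also have "|D \<times> F n| \<le>o |D \<times> D|" using Suc.IH by (rule card_of_Times_mono2)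
    also have "|D \<times> D| =o |D|" using assms by (rule card_of_Times_same_infinite)
    finally show ?case .
  qed
  have "Fpow D = (\<Union>n\<in>UNIV. F n)" unfolding F_def Fpow_def by auto
  moreover have "|\<Union>n\<in>UNIV. F n| \<le>o |D|"
    using F assms by (intro card_of_UNION_ordLeq_infinite) (auto simp: infinite_iff_card_of_nat)
  ultimately show ?thesis by simp
qed

lemma card_Fpow_less:
  assumes "infinite T" "|D| <o |T|" shows "|Fpow D| <o |T|"
proof (cases "finite D")
  case True
  then have "finite (Fpow D)" using Fpow_subset_Pow finite_subset by fastforce
  then show ?thesis using assms finite_card_less_infinite by blast
next
  case False
  then show ?thesis using assms card_Fpow_infinite ordLeq_ordLess_trans by blast
qed

lemma card_underS_less: "t \<in> T \<Longrightarrow> |underS |T| t| <o |T|"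
  by (rule card_of_underS[OF card_of_Card_order]) (simp add: Field_card_of)

lemma card_under_less:
  assumes "infinite T" "t \<in> T" shows "|under |T| t| <o |T|"
proof -
  have "|underS |T| t| <o |T|"
    using assms(2) by (rule card_underS_less)
  moreover have "|{t}| <o |T|"
    by (rule finite_card_less_infinite[OF _ assms(1)]) simp
  ultimately have "|underS |T| t \<union> {t}| <o |T|"
    using assms(1) card_of_Un_ordLess_infinite by blast
  moreover have "under |T| t \<subseteq> underS |T| t \<union> {t}" unfolding under_def underS_def by auto
  ultimately show ?thesis using card_of_mono1 ordLeq_ordLess_trans by blast
qed

lemma card_of_finite_subset_max:
  assumes "finite F" "F \<noteq> {}" "F \<subseteq> T"
  obtains m where "m \<in> F" "\<And>s. s \<in> F \<Longrightarrow> (s, m) \<in> |T|"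
proof -
  have r: "total_on T |T|" "trans |T|" "refl_on T |T|"
    using card_of_well_order_on[of T]
    by (auto simp: well_order_on_def linear_order_on_def partial_order_on_def preorder_on_def)
  have "\<exists>m\<in>F. \<forall>s\<in>F. (s, m) \<in> |T|"
    using assms
  proof (induction F rule: finite_ne_induct)
    case (singleton x)
    then show ?case using r(3) by (auto simp: refl_on_def)
  next
    case (insert x F)
    then obtain m where m: "m \<in> F" "\<forall>s\<in>F. (s, m) \<in> |T|" by auto
    have "(x, m) \<in> |T| \<or> (m, x) \<in> |T|"
      using m(1) insert.prems r(1,3) by (cases "x = m") (auto simp: total_on_def refl_on_def)
    then show ?case
    proof
      assume "(m, x) \<in> |T|"
      then have "\<forall>s\<in>insert x F. (s, x) \<in> |T|"
        using m r(2,3) insert.prems by (auto simp: refl_on_def dest: transD)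
      then show ?case by blast
    qed (use m in auto)
  qed
  then show thesis using that by blast
qed

text \<open>Every stage strictly after the maximum of \<open>F\<close> has \<open>F\<close> strictly
  below it. The empty set has no maximum and is a case of its own; there every stage
  qualifies.\<close>

lemma finite_subset_underS_cases:
  assumes "finite F" "F \<subseteq> T"
  obtains "F = {}" | m where "m \<in> F" "\<And>t. \<lbrakk>t \<in> T; t \<notin> under |T| m\<rbrakk> \<Longrightarrow> F \<subseteq> underS |T| t"
proof (cases "F = {}")
  case False
  then obtain m where m: "m \<in> F" "\<And>s. s \<in> F \<Longrightarrow> (s, m) \<in> |T|"
    using card_of_finite_subset_max[OF assms(1) False assms(2)] by blast
  have r: "total_on T |T|" "trans |T|" "antisym |T|" "refl_on T |T|"
    using card_of_well_order_on[of T]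
    by (auto simp: well_order_on_def linear_order_on_def partial_order_on_def preorder_on_def)
  have "F \<subseteq> underS |T| t" if t: "t \<in> T" "t \<notin> under |T| m" for t
  proof
    fix s assume "s \<in> F"
    then have sm: "(s, m) \<in> |T|" using m(2) by blast
    have "(t, m) \<notin> |T|" using t(2) unfolding under_def by blast
    moreover have "m \<in> T" using m(1) assms(2) by blast
    ultimately have "(m, t) \<in> |T|" using r(1,4) t(1) by (cases "m = t") (auto simp: total_on_def refl_on_def)
    then have "(s, t) \<in> |T|" using sm r(2) by (blast dest: transD)
    moreover have "s \<noteq> t" using sm \<open>(t, m) \<notin> |T|\<close> by blast
    ultimately show "s \<in> underS |T| t" unfolding underS_def by blast
  qed
  then show thesis using that(2) m(1) by blast
qed (use that in blast)

section \<open>Bases\<close>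

lemma regular_base_shrink:
  assumes "regular_space X" "is_base X \<B>" "openin X W" "p \<in> W"
  obtains U where "U \<in> \<B>" "p \<in> U" "X closure_of U \<subseteq> W"
proof -
  obtain U C where U: "openin X U" "closedin X C" "p \<in> U" "U \<subseteq> C" "C \<subseteq> W"
    using assms(1,3,4) neighbourhood_base_of_closedin[of X]
    unfolding neighbourhood_base_of by blast
  then obtain V where V: "V \<in> \<B>" "p \<in> V" "V \<subseteq> U"
    using assms(2) unfolding is_base_def by blast
  then have "X closure_of V \<subseteq> C" using U by (meson closure_of_minimal order_trans)
  then show thesis using that V U by blast
qed

text \<open>A local pi-base at \<open>p\<close> has at least \<open>|\<A>|\<close> members. A
  smaller family of nonempty open sets can therefore fail only by missing some neighbourhood of
  \<open>p\<close>.\<close>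

lemma small_family_not_local_pi_base:
  assumes "pi_char_eq_weight X p" "realizes_weight X \<A>"
    and "|\<N>| <o |\<A>|" "\<And>V. V \<in> \<N> \<Longrightarrow> openin X V \<and> V \<noteq> {}"
  obtains U where "openin X U" "p \<in> U" "\<forall>V\<in>\<N>. \<not> V \<subseteq> U"
proof -
  obtain \<P> \<B> where P: "realizes_pi_char X p \<P>" "realizes_weight X \<B>" "|\<P>| =o |\<B>|"
    using assms(1) unfolding pi_char_eq_weight_def by blast
  have "|\<A>| \<le>o |\<B>|" using assms(2) P(2) unfolding realizes_weight_def by blast
  then have "|\<A>| \<le>o |\<P>|" using P(3) ordIso_symmetric ordLeq_ordIso_trans by blast
  then have "\<not> |\<P>| \<le>o |\<N>|"
    using assms(3) not_ordLess_ordLeq ordLeq_transitive by blast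
  then have "\<not> is_local_pi_base X p \<N>" using P(1) unfolding realizes_pi_char_def by blast
  then show thesis using that assms(4) unfolding is_local_pi_base_def by blast
qed

section \<open>Finite unions of basic boxes\<close>

locale compacta_image =
  fixes K :: "'k set" and I :: "'i set" and Y :: "'i \<Rightarrow> 'b topology"
    and N :: "'i \<Rightarrow> 'k \<Rightarrow> 'b set" and X :: "'a topology" and f :: "('i \<Rightarrow> 'b) \<Rightarrow> 'a"
  assumes infinite_K: "infinite K"
    and compact_factor: "\<And>i. i \<in> I \<Longrightarrow> compact_space (Y i)"
    and base_factor: "\<And>i. i \<in> I \<Longrightarrow> is_base (Y i) (N i ` K)"
    and Hausdorff: "Hausdorff_space X"
    and cont: "continuous_map (product_topology Y I) X f"
    and surj: "f ` topspace (product_topology Y I) = topspace X"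
begin

abbreviation P where "P \<equiv> product_topology Y I"

abbreviation pre where "pre V \<equiv> {x \<in> topspace P. f x \<in> V}"

text \<open>A pair \<open>(i, k)\<close> stands for the \<open>k\<close>-th basic open set of the \<open>i\<close>-th factor.\<close>

definition box :: "('i \<times> 'k) set \<Rightarrow> ('i \<Rightarrow> 'b) set" where
  "box a = {x \<in> topspace P. \<forall>(i, k)\<in>a. x i \<in> N i k}"

definition region :: "('i \<times> 'k) set set \<Rightarrow> ('i \<Rightarrow> 'b) set" where
  "region g = (\<Union>a\<in>g. box a)"

text \<open>Depends on the code \<open>g\<close> and not just on the set \<open>region g\<close>:
  every coordinate mentioned in \<open>g\<close> counts.\<close>

definition supp :: "('i \<times> 'k) set set \<Rightarrow> 'i set" where
  "supp g = fst ` \<Union>g"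

lemma compact_P: "compact_space P"
  using compact_factor by (simp add: compact_space_product_topology)

lemma compact_X: "compact_space X"
  using image_compactin[OF _ cont, of "topspace P"] compact_P surj
  by (simp add: compact_space_def)

lemma regular_X: "regular_space X"
  using compact_X Hausdorff compact_Hausdorff_imp_regular_space by blast

lemma subset_if_pre_subset:
  assumes "openin X V" "pre V \<subseteq> pre W" shows "V \<subseteq> W"
proof
  fix v assume "v \<in> V"
  moreover from this have "v \<in> f ` topspace P" using assms(1) surj openin_subset by blast
  then obtain x where "x \<in> topspace P" "v = f x" by (rule imageE)
  ultimately show "v \<in> W" using assms(2) by blast
qed

lemma finite_supp: "g \<in> Fpow (Fpow D) \<Longrightarrow> finite (supp g)"
  unfolding supp_def Fpow_def by auto

lemma openin_box:
  assumes "a \<in> Fpow (I \<times> K)" shows "openin P (box a)"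
proof -
  have "openin P {x \<in> topspace P. x i \<in> N i k}" if "(i, k) \<in> a" for i k
  proof -
    have "i \<in> I" "k \<in> K" using that assms unfolding Fpow_def by auto
    then have "openin (Y i) (N i k)" using base_factor unfolding is_base_def by blast
    then show ?thesis
      by (rule openin_continuous_map_preimage[OF continuous_map_product_projection[OF \<open>i \<in> I\<close>]])
  qed
  then have "openin P (topspace P \<inter> (\<Inter>(i, k)\<in>a. {x \<in> topspace P. x i \<in> N i k}))"
    using assms unfolding Fpow_def by (intro openin_Int_Inter openin_topspace) auto
  moreover have "box a = topspace P \<inter> (\<Inter>(i, k)\<in>a. {x \<in> topspace P. x i \<in> N i k})"
    unfolding box_def by auto
  ultimately show ?thesis by simp
qed

lemma box_neighbourhood:
  assumes "openin P W" "z \<in> W"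
  obtains a where "a \<in> Fpow (I \<times> K)" "z \<in> box a" "box a \<subseteq> W"
proof -
  have "\<exists>U. finite {i \<in> I. U i \<noteq> topspace (Y i)} \<and> (\<forall>i\<in>I. openin (Y i) (U i)) \<and>
      z \<in> Pi\<^sub>E I U \<and> Pi\<^sub>E I U \<subseteq> W"
    using assms openin_product_topology_alt[of Y I W] by simp
  then obtain U where U: "finite {i \<in> I. U i \<noteq> topspace (Y i)}" "\<And>i. i \<in> I \<Longrightarrow> openin (Y i) (U i)"
      "z \<in> Pi\<^sub>E I U" "Pi\<^sub>E I U \<subseteq> W"
    by auto
  let ?J = "{i \<in> I. U i \<noteq> topspace (Y i)}"
  have "\<exists>k\<in>K. z i \<in> N i k \<and> N i k \<subseteq> U i" if "i \<in> I" for i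
  proof -
    have "z i \<in> U i" using U(3) that by auto
    then show ?thesis using base_factor[OF that] U(2)[OF that] unfolding is_base_def by blast
  qed
  then obtain k where k: "\<And>i. i \<in> I \<Longrightarrow> k i \<in> K \<and> z i \<in> N i (k i) \<and> N i (k i) \<subseteq> U i"
    by metis
  have zP: "z \<in> topspace P" using assms openin_subset by blast
  let ?a = "(\<lambda>i. (i, k i)) ` ?J"
  show thesis
  proof
    show "?a \<in> Fpow (I \<times> K)" using U(1) k unfolding Fpow_def by auto
    show "z \<in> box ?a" using k zP unfolding box_def by auto
    have "x \<in> Pi\<^sub>E I U" if "x \<in> box ?a" for x
    proof -
      have x: "x \<in> Pi\<^sub>E I (\<lambda>i. topspace (Y i))" "\<And>i. i \<in> ?J \<Longrightarrow> x i \<in> N i (k i)"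
        using that unfolding box_def by (auto simp: topspace_product_topology)
      have "x i \<in> U i" if "i \<in> I" for i
      proof (cases "U i = topspace (Y i)")
        case True
        then show ?thesis using x(1) that by auto
      next
        case False
        then show ?thesis using x(2)[of i] k[OF that] that by auto
      qed
      then show ?thesis using x(1) unfolding PiE_iff by blast
    qed
    then have "box ?a \<subseteq> Pi\<^sub>E I U" by (rule subsetI)
    then show "box ?a \<subseteq> W" using U(4) by (rule subset_trans)
  qed
qed

text \<open>Cover \<open>Z\<close> by boxes around its points inside \<open>W\<close> and take a
  finite subcover. Each box contains the point it was chosen for, which gives the nonemptiness that
  \<open>region_restrict\<close> relies on.\<close>

lemma region_between:
  assumes "compactin P Z" "openin P W" "Z \<subseteq> W"
  obtains g where "g \<in> Fpow (Fpow (I \<times> K))" "\<forall>a\<in>g. box a \<noteq> {}"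
    "Z \<subseteq> region g" "region g \<subseteq> W"
proof -
  have "\<exists>a. a \<in> Fpow (I \<times> K) \<and> z \<in> box a \<and> box a \<subseteq> W" if "z \<in> Z" for z
    using box_neighbourhood[OF assms(2), of z] assms(3) that by blast
  then obtain a where a: "\<And>z. z \<in> Z \<Longrightarrow> a z \<in> Fpow (I \<times> K) \<and> z \<in> box (a z) \<and> box (a z) \<subseteq> W"
    by metis
  have "\<exists>\<F>. finite \<F> \<and> \<F> \<subseteq> (\<lambda>z. box (a z)) ` Z \<and> Z \<subseteq> \<Union>\<F>"
    using assms(1) a openin_box by (intro compactinD) auto
  then obtain S where S: "finite S" "S \<subseteq> Z" "Z \<subseteq> (\<Union>z\<in>S. box (a z))"
    by (metis finite_subset_image)
  show thesis
  proof
    have "a ` S \<subseteq> Fpow (I \<times> K)" using S(2) a by blast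
    then show "a ` S \<in> Fpow (Fpow (I \<times> K))" using S(1) by (simp add: Fpow_def[of "Fpow _"])
    show "\<forall>b\<in>a ` S. box b \<noteq> {}" using a S(2) by blast
  qed (use S a in \<open>auto simp: region_def\<close>)
qed

text \<open>Splicing: change a point of a box of \<open>g\<close> to agree with \<open>x\<close> on
  \<open>J\<close>. If \<open>x\<close> satisfies the constraints of that box on \<open>J\<close>,
  the result is still in the box, hence in \<open>region h\<close>, and \<open>h\<close> sees only
  coordinates in \<open>J\<close>.\<close>

lemma region_restrict:
  assumes g: "\<forall>a\<in>g. box a \<noteq> {}" "region g \<subseteq> region h" and J: "supp h \<subseteq> J"
  shows "region ((\<lambda>a. a \<inter> J \<times> UNIV) ` g) \<subseteq> region h"
proof
  fix x assume "x \<in> region ((\<lambda>a. a \<inter> J \<times> UNIV) ` g)"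
  then obtain a where a: "a \<in> g" "x \<in> box (a \<inter> J \<times> UNIV)" unfolding region_def by auto
  obtain y where y: "y \<in> box a" using g(1) a(1) by blast
  define z where "z = (\<lambda>i. if i \<in> J then x i else y i)"
  have "z \<in> topspace P"
    using a(2) y unfolding z_def box_def by (auto simp: PiE_iff extensional_def)
  moreover have "z i \<in> N i k" if "(i, k) \<in> a" for i k
    using that a(2) y unfolding z_def box_def by auto
  ultimately have "z \<in> box a" unfolding box_def by auto
  then have "z \<in> region h" using a(1) g(2) unfolding region_def by blast
  then obtain b where b: "b \<in> h" "z \<in> box b" unfolding region_def by blast
  have "x i \<in> N i k" if "(i, k) \<in> b" for i k
  proof -
    have "i \<in> J" using that b(1) J unfolding supp_def by force
    moreover have "z i \<in> N i k" using b(2) that unfolding box_def by auto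
    ultimately show ?thesis by (simp add: z_def)
  qed
  then have "x \<in> box b" using a(2) unfolding box_def by auto
  then show "x \<in> region h" using b(1) unfolding region_def by blast
qed

lemma region_around_closure:
  assumes "openin X W" "X closure_of U \<subseteq> W"
  obtains g where "g \<in> Fpow (Fpow (I \<times> K))" "\<forall>a\<in>g. box a \<noteq> {}"
    "pre (X closure_of U) \<subseteq> region g" "region g \<subseteq> pre W"
proof (rule region_between)
  show "compactin P (pre (X closure_of U))"
    by (rule closedin_compact_space[OF compact_P closedin_continuous_map_preimage[OF cont closedin_closure_of]])
  show "openin P (pre W)" using cont assms(1) openin_continuous_map_preimage by blast
qed (use assms(2) in auto)

section \<open>Reflection\<close>

text \<open>Being a function of the code \<open>b\<close>, it yields no more cores than there are
  codes. The value is meaningful only for \<open>large b\<close>.\<close>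

definition core :: "('i \<times> 'k) set set \<Rightarrow> 'a set" where
  "core b = (SOME V. openin X V \<and> V \<noteq> {} \<and> pre V \<subseteq> region b)"

definition large :: "('i \<times> 'k) set set \<Rightarrow> bool" where
  "large b \<longleftrightarrow> (\<exists>V. openin X V \<and> V \<noteq> {} \<and> pre V \<subseteq> region b)"

lemma core:
  assumes "large b" shows "openin X (core b)" "core b \<noteq> {}" "pre (core b) \<subseteq> region b"
  using someI_ex[OF assms[unfolded large_def]] unfolding core_def by auto

lemma reflection:
  assumes "openin X V" "V \<noteq> {}"
  obtains b where "b \<in> Fpow (Fpow ((J \<inter> I) \<times> K))" "large b"
    "\<forall>h. pre V \<subseteq> region h \<and> supp h \<subseteq> J \<longrightarrow> pre (core b) \<subseteq> region h"
proof -
  obtain p where "p \<in> V" using assms by blast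
  moreover have "is_base X {U. openin X U}" unfolding is_base_def by auto
  \<comment> \<open>The closure of \<open>U\<close> has a compact preimage, which leaves room for a
    finite union of boxes below the preimage of \<open>V\<close>.\<close>
  ultimately obtain U where U: "openin X U" "p \<in> U" "X closure_of U \<subseteq> V"
    using regular_base_shrink[OF regular_X _ assms(1)] by (metis mem_Collect_eq)
  obtain g where g: "g \<in> Fpow (Fpow (I \<times> K))" "\<forall>a\<in>g. box a \<noteq> {}"
      "pre (X closure_of U) \<subseteq> region g" "region g \<subseteq> pre V"
    by (rule region_around_closure[OF assms(1) U(3)])
  let ?b = "(\<lambda>a. a \<inter> J \<times> UNIV) ` g"
  \<comment> \<open>Dropping constraints enlarges the region, so it still contains the preimage of
    \<open>U\<close>; this makes \<open>?b\<close> large.\<close>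
  have "region g \<subseteq> region ?b" unfolding region_def box_def by auto
  moreover have "U \<subseteq> X closure_of U" using U(1) by (simp add: closure_of_subset openin_subset)
  ultimately have "pre U \<subseteq> region ?b" using g(3) by blast
  then have large: "large ?b" using U unfolding large_def by blast
  show thesis
  proof
    show "?b \<in> Fpow (Fpow ((J \<inter> I) \<times> K))" using g(1) unfolding Fpow_def by auto
    show "large ?b" by (rule large)
    show "\<forall>h. pre V \<subseteq> region h \<and> supp h \<subseteq> J \<longrightarrow> pre (core ?b) \<subseteq> region h"
    proof (intro allI impI, elim conjE)
      fix h assume h: "pre V \<subseteq> region h" "supp h \<subseteq> J"
      then have "region ?b \<subseteq> region h"
        by (intro region_restrict[OF g(2)] subset_trans[OF g(4)])
      then show "pre (core ?b) \<subseteq> region h" using core(3)[OF large] by blast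
    qed
  qed
qed

section \<open>Avoiding covers\<close>

text \<open>The pair \<open>u\<close> is a task of refinement, void unless the closure of its first
  set lies in the second. Each chosen \<open>U\<close> carries the code \<open>g\<close> of a region
  enclosing its preimage.\<close>

definition cover_task :: "'a set set \<Rightarrow> 'a set \<times> 'a set \<Rightarrow> ('a set \<times> ('i \<times> 'k) set set) set \<Rightarrow> bool" where
  "cover_task \<B> u c \<longleftrightarrow> finite c \<and>
     (\<forall>(U, g)\<in>c. U \<in> \<B> \<and> U \<subseteq> snd u \<and> g \<in> Fpow (Fpow (I \<times> K)) \<and> pre U \<subseteq> region g) \<and>
     (X closure_of fst u \<subseteq> snd u \<longrightarrow> fst u \<subseteq> \<Union>(fst ` c))"

text \<open>Tested on the enclosing regions rather than on the sets \<open>U\<close>, since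
  reflection speaks about regions. A set contained in some chosen \<open>U\<close> hits in this
  sense.\<close>

definition hits :: "('a set \<times> ('i \<times> 'k) set set) set \<Rightarrow> 'a set \<Rightarrow> bool" where
  "hits c V \<longleftrightarrow> (\<exists>U g. (U, g) \<in> c \<and> pre V \<subseteq> region g)"

text \<open>Fewer than \<open>|\<A>|\<close> cores are not a local pi-base at any point, so each
  point of the closure has a neighbourhood containing no core. Choose \<open>U\<close> and its
  region inside it, then use compactness of the closure.\<close>

lemma cover_task_avoiding:
  assumes pw: "\<And>p. p \<in> topspace X \<Longrightarrow> pi_char_eq_weight X p"
    and A: "realizes_weight X \<A>" and B: "is_base X \<B>"
    and u: "openin X (fst u)" "openin X (snd u)" and D: "|D| <o |\<A>|" "\<And>b. b \<in> D \<Longrightarrow> large b"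
  obtains c where "cover_task \<B> u c" "\<forall>b\<in>D. \<not> hits c (core b)"
proof (cases "X closure_of fst u \<subseteq> snd u")
  case False
  then have "cover_task \<B> u {}" unfolding cover_task_def by auto
  then show thesis using that[of "{}"] unfolding hits_def by simp
next
  case True
  \<comment> \<open>The pair \<open>h\<close> is an admissible member of the cover whose first set
    contains \<open>p\<close>.\<close>
  define good where "good p h \<longleftrightarrow> p \<in> fst h \<and> fst h \<in> \<B> \<and> fst h \<subseteq> snd u \<and>
      snd h \<in> Fpow (Fpow (I \<times> K)) \<and> pre (fst h) \<subseteq> region (snd h) \<and>
      (\<forall>b\<in>D. \<not> pre (core b) \<subseteq> region (snd h))" for p h
  have "\<exists>h. good p h" if p: "p \<in> X closure_of fst u" for p
  proof -
    have pX: "p \<in> topspace X" using p in_closure_of by fast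
    have "|core ` D| <o |\<A>|" using D(1) card_of_image ordLeq_ordLess_trans by blast
    moreover have "openin X V \<and> V \<noteq> {}" if "V \<in> core ` D" for V
      using that core(1,2)[OF D(2)] by blast
    ultimately obtain U2 where U2: "openin X U2" "p \<in> U2" "\<forall>V\<in>core ` D. \<not> V \<subseteq> U2"
      by (rule small_family_not_local_pi_base[OF pw[OF pX] A])
    let ?W = "U2 \<inter> snd u"
    have W: "openin X ?W" "p \<in> ?W" using U2 u p True by auto
    obtain U where U: "U \<in> \<B>" "p \<in> U" "X closure_of U \<subseteq> ?W"
      by (rule regular_base_shrink[OF regular_X B W])
    obtain g where g: "g \<in> Fpow (Fpow (I \<times> K))" "\<forall>a\<in>g. box a \<noteq> {}"
        "pre (X closure_of U) \<subseteq> region g" "region g \<subseteq> pre ?W"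
      by (rule region_around_closure[OF W(1) U(3)])
    have "openin X U" using U(1) B unfolding is_base_def by blast
    then have UC: "U \<subseteq> X closure_of U" by (simp add: closure_of_subset openin_subset)
    have "\<not> pre (core b) \<subseteq> region g" if "b \<in> D" for b
    proof
      assume "pre (core b) \<subseteq> region g"
      then have "pre (core b) \<subseteq> pre ?W" using g(4) by (rule subset_trans)
      then have "core b \<subseteq> ?W"
        by (rule subset_if_pre_subset[OF core(1)[OF D(2)[OF that]]])
      then show False using U2(3) that by blast
    qed
    moreover have "pre U \<subseteq> region g" using UC g(3) by blast
    moreover have "U \<subseteq> snd u" using U(3) UC by blast
    ultimately have "good p (U, g)" using U(1,2) g(1) unfolding good_def by simp
    then show ?thesis by blast
  qed
  then obtain h where h: "\<And>p. p \<in> X closure_of fst u \<Longrightarrow> good p (h p)" by metis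
  have "compactin X (X closure_of fst u)" by (rule closedin_compact_space[OF compact_X closedin_closure_of])
  then have "\<exists>\<F>. finite \<F> \<and> \<F> \<subseteq> (\<lambda>p. fst (h p)) ` (X closure_of fst u) \<and> X closure_of fst u \<subseteq> \<Union>\<F>"
  proof (rule compactinD)
    have h': "p \<in> fst (h p)" "fst (h p) \<in> \<B>" if "p \<in> X closure_of fst u" for p
      using h[OF that] unfolding good_def by simp_all
    show "openin X V" if "V \<in> (\<lambda>p. fst (h p)) ` (X closure_of fst u)" for V
      using that h'(2) B unfolding is_base_def by blast
    show "X closure_of fst u \<subseteq> \<Union>((\<lambda>p. fst (h p)) ` (X closure_of fst u))"
      using h'(1) by blast
  qed
  then obtain S where S: "finite S" "S \<subseteq> X closure_of fst u" "X closure_of fst u \<subseteq> (\<Union>p\<in>S. fst (h p))"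
    using finite_subset_image by metis
  have "fst u \<subseteq> X closure_of fst u" using u(1) by (simp add: closure_of_subset openin_subset)
  then have cov: "fst u \<subseteq> \<Union>(fst ` h ` S)" using S(3) by blast
  have good: "\<exists>p. good p x" if "x \<in> h ` S" for x using that h S(2) by blast
  show thesis
  proof
    show "cover_task \<B> u (h ` S)"
      unfolding cover_task_def
    proof (intro conjI)
      show "\<forall>(U, g)\<in>h ` S. U \<in> \<B> \<and> U \<subseteq> snd u \<and> g \<in> Fpow (Fpow (I \<times> K)) \<and> pre U \<subseteq> region g"
      proof (intro ballI case_prodI2)
        fix x U g assume "x \<in> h ` S" "x = (U, g)"
        then show "U \<in> \<B> \<and> U \<subseteq> snd u \<and> g \<in> Fpow (Fpow (I \<times> K)) \<and> pre U \<subseteq> region g"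
          using good[of x] unfolding good_def by simp
      qed
    qed (use S(1) cov in simp_all)
    show "\<forall>b\<in>D. \<not> hits (h ` S) (core b)"
    proof (intro ballI notI)
      fix b assume b: "b \<in> D" "hits (h ` S) (core b)"
      then obtain U g where Ug: "(U, g) \<in> h ` S" "pre (core b) \<subseteq> region g" unfolding hits_def by blast
      have "\<not> pre (core b) \<subseteq> region g" using good[OF Ug(1)] b(1) unfolding good_def by simp
      then show False using Ug(2) by (rule notE)
    qed
  qed
qed

text \<open>The parameter \<open>L t\<close> limits the labels \<open>k\<close> of the pairs \<open>(i, k)\<close> considered at stage \<open>t\<close>: at
  weight \<open>\<kappa>\<close> allowing all of \<open>K\<close> would give too many cores to avoid.\<close>

definition avoiding :: "'t set \<Rightarrow> ('t \<Rightarrow> 'k set) \<Rightarrow> ('t \<Rightarrow> ('a set \<times> ('i \<times> 'k) set set) set) \<Rightarrow> bool" where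
  "avoiding T L c \<longleftrightarrow> (\<forall>t\<in>T. \<forall>b\<in>Fpow (Fpow ((\<Union>s\<in>underS |T| t. \<Union>(supp ` snd ` c s)) \<times> L t)).
     large b \<longrightarrow> \<not> hits (c t) (core b))"

text \<open>Recursion along the well-order of \<open>T\<close>. The earlier stages contribute
  finitely many coordinates each, so fewer than \<open>|T|\<close> codes, and hence cores, have to
  be avoided at stage \<open>t\<close>.\<close>

lemma avoiding_sequence:
  assumes pw: "\<And>p. p \<in> topspace X \<Longrightarrow> pi_char_eq_weight X p"
    and A: "realizes_weight X \<A>" and B: "is_base X \<B>"
    and T: "infinite T" "|T| \<le>o |\<A>|" and \<tau>: "\<And>t. t \<in> T \<Longrightarrow> \<tau> t \<in> \<A> \<times> \<A>"
    and L: "\<And>t. t \<in> T \<Longrightarrow> |L t| <o |T|"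
  shows "\<exists>c. (\<forall>t\<in>T. cover_task \<B> (\<tau> t) (c t)) \<and> avoiding T L c"
proof -
  define D where "D c t = Fpow (Fpow ((\<Union>s\<in>underS |T| t. \<Union>(supp ` snd ` c s)) \<times> L t))"
    for c :: "'c \<Rightarrow> ('a set \<times> ('i \<times> 'k) set set) set" and t
  \<comment> \<open>The guard \<open>t \<in> T\<close> is there because the choice principle runs
    over the whole type.\<close>
  define Q where "Q c t x \<longleftrightarrow> (t \<in> T \<longrightarrow> cover_task \<B> (\<tau> t) x \<and>
      (\<forall>b\<in>D c t. large b \<longrightarrow> \<not> hits x (core b)))" for c t x
  have "\<exists>c. \<forall>t. Q c t (c t)"
  proof (rule dependent_wf_choice)
    show "wf ( |T| - Id)" using card_of_well_order_on[of T] by (simp add: well_order_on_def)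
  next
    fix c d :: "'c \<Rightarrow> ('a set \<times> ('i \<times> 'k) set set) set" and t x
    assume "\<And>s. (s, t) \<in> |T| - Id \<Longrightarrow> c s = d s"
    then have "c s = d s" if "s \<in> underS |T| t" for s using that unfolding underS_def by auto
    then have "D c t = D d t" unfolding D_def by simp
    then show "Q c t x = Q d t x" unfolding Q_def by simp
  next
    fix t and c :: "'c \<Rightarrow> ('a set \<times> ('i \<times> 'k) set set) set"
    assume IH: "\<And>s. (s, t) \<in> |T| - Id \<Longrightarrow> Q c s (c s)"
    show "\<exists>x. Q c t x"
    proof (cases "t \<in> T")
      case False
      then show ?thesis unfolding Q_def by blast
    next
      case True
      have fin: "finite (\<Union>(supp ` snd ` c s))" if "s \<in> underS |T| t" for s
      proof -
        have "(s, t) \<in> |T| - Id" using that unfolding underS_def by auto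
        moreover from this have "s \<in> T" using FieldI1 Field_card_of by fastforce
        ultimately have "cover_task \<B> (\<tau> s) (c s)" using IH unfolding Q_def by blast
        then show ?thesis unfolding cover_task_def using finite_supp by fastforce
      qed
      have "|\<Union>s\<in>underS |T| t. \<Union>(supp ` snd ` c s)| <o |T|"
        by (rule card_UN_finite_less[OF T(1) card_underS_less[OF True] fin])
      then have DT: "|D c t| <o |T|" unfolding D_def
        using L[OF True] T(1) by (intro card_Fpow_less card_Times_less)
      have "|{b \<in> D c t. large b}| \<le>o |D c t|" by (rule card_of_mono1) blast
      then have D\<A>: "|{b \<in> D c t. large b}| <o |\<A>|"
        using ordLess_ordLeq_trans[OF DT T(2)] by (rule ordLeq_ordLess_trans)
      have op: "openin X (fst (\<tau> t))" "openin X (snd (\<tau> t))"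
        using \<tau>[OF True] A unfolding realizes_weight_def is_base_def by auto
      obtain x where "cover_task \<B> (\<tau> t) x"
          "\<forall>b\<in>{b \<in> D c t. large b}. \<not> hits x (core b)"
        by (rule cover_task_avoiding[OF pw A B op D\<A>]) auto
      then have "Q c t x" unfolding Q_def by blast
      then show ?thesis by blast
    qed
  qed
  then obtain c where "\<And>t. Q c t (c t)" by blast
  then have "\<forall>t\<in>T. cover_task \<B> (\<tau> t) (c t)" "avoiding T L c"
    unfolding Q_def D_def avoiding_def by blast+
  then show ?thesis by blast
qed

section \<open>The chosen sets as a base, and their supersets\<close>

text \<open>Between \<open>x\<close> and \<open>U\<close> place a pair of members of
  \<open>\<A>\<close>, the closure of the smaller inside the larger; the stage handling this pair
  supplies the basic set. The empty set is removed because it lies in every member.\<close>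

lemma cover_tasks_base:
  assumes A: "is_base X \<A>" and B: "is_base X \<B>" and \<tau>: "\<A> \<times> \<A> \<subseteq> \<tau> ` T"
    and c: "\<And>t. t \<in> T \<Longrightarrow> cover_task \<B> (\<tau> t) (c t)"
  shows "(\<Union>t\<in>T. fst ` c t) - {{}} \<subseteq> \<B>" "is_base X ((\<Union>t\<in>T. fst ` c t) - {{}})"
proof -
  let ?C = "(\<Union>t\<in>T. fst ` c t) - {{}}"
  have "fst ` c t \<subseteq> \<B>" if "t \<in> T" for t using c[OF that] unfolding cover_task_def by auto
  then show sub: "?C \<subseteq> \<B>" by blast
  have "\<exists>V\<in>?C. x \<in> V \<and> V \<subseteq> U" if U: "openin X U" "x \<in> U" for U x
  proof -
    have "\<exists>U1\<in>\<A>. x \<in> U1 \<and> U1 \<subseteq> U" using A U unfolding is_base_def by simp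
    then obtain U1 where U1: "U1 \<in> \<A>" "x \<in> U1" "U1 \<subseteq> U" by blast
    then have "openin X U1" using A unfolding is_base_def by blast
    then obtain U0 where U0: "U0 \<in> \<A>" "x \<in> U0" "X closure_of U0 \<subseteq> U1"
      using regular_base_shrink[OF regular_X A _ U1(2)] by blast
    obtain t where t: "t \<in> T" "\<tau> t = (U0, U1)" using \<tau> U0(1) U1(1) by fastforce
    then have ct: "U0 \<subseteq> \<Union>(fst ` c t)" "\<forall>(V, g)\<in>c t. V \<subseteq> U1"
      using c[OF t(1)] U0(3) unfolding cover_task_def by auto
    then obtain V where V: "V \<in> fst ` c t" "x \<in> V" using U0(2) by blast
    then have "V \<subseteq> U" using ct(2) U1(3) by fastforce
    then show ?thesis using V t(1) by blast
  qed
  moreover have "openin X V" if "V \<in> ?C" for V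
    using subsetD[OF sub that] B unfolding is_base_def by blast
  ultimately show "is_base X ?C" unfolding is_base_def by blast
qed

text \<open>Any member containing \<open>V\<close> was chosen at a stage that \<open>V\<close> hits,
  and each stage chooses only finitely many sets.\<close>

lemma op_like_if_few_indices:
  fixes \<kappa> :: "'m set"
  assumes B: "is_base X \<B>" and \<kappa>: "infinite \<kappa>"
    and c: "\<And>t. t \<in> T \<Longrightarrow> cover_task \<B> (\<tau> t) (c t)"
    and few: "\<And>V. \<lbrakk>openin X V; V \<noteq> {}\<rbrakk> \<Longrightarrow> |{t \<in> T. hits (c t) V}| <o |\<kappa>|"
  shows "op_like \<kappa> ((\<Union>t\<in>T. fst ` c t) - {{}})"
  unfolding op_like_def
proof
  let ?C = "(\<Union>t\<in>T. fst ` c t) - {{}}"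
  fix V assume V: "V \<in> ?C"
  then obtain t where "t \<in> T" "V \<in> fst ` c t" by blast
  then have "V \<in> \<B>" using c[of t] unfolding cover_task_def by auto
  then have oV: "openin X V" "V \<noteq> {}" using B V unfolding is_base_def by auto
  let ?S = "{t \<in> T. hits (c t) V}"
  have "|\<Union>t\<in>?S. fst ` c t| <o |\<kappa>|"
    using c by (intro card_UN_finite_less[OF \<kappa> few[OF oV]]) (auto simp: cover_task_def)
  moreover have "{U \<in> ?C. V \<subseteq> U} \<subseteq> (\<Union>t\<in>?S. fst ` c t)"
  proof
    fix U assume "U \<in> {U \<in> ?C. V \<subseteq> U}"
    then obtain t g where t: "t \<in> T" "(U, g) \<in> c t" "V \<subseteq> U" by auto
    then have "pre U \<subseteq> region g" using c[OF t(1)] unfolding cover_task_def by blast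
    then have "pre V \<subseteq> region g" using t(3) by blast
    then have "hits (c t) V" using t(2) unfolding hits_def by blast
    then show "U \<in> (\<Union>t\<in>?S. fst ` c t)" using t by force
  qed
  ultimately show "|{U \<in> ?C. V \<subseteq> U}| <o |\<kappa>|"
    using card_of_mono1 ordLeq_ordLess_trans by blast
qed

section \<open>Bounding the stages hit by an open set\<close>

text \<open>Reflect \<open>V\<close> to the coordinates used by the stages in \<open>S\<close>. The
  code \<open>b\<close> is finite, so finitely many stages \<open>F\<close> already supply its
  coordinates.\<close>

lemma reflection_into_indices:
  assumes "openin X V" "V \<noteq> {}" "S \<subseteq> T"
    and c: "\<And>t. t \<in> T \<Longrightarrow> cover_task \<B> (\<tau> t) (c t)"
  obtains b F where "finite F" "F \<subseteq> S" "large b" "b \<in> Fpow (Fpow ((\<Union>s\<in>F. \<Union>(supp ` snd ` c s)) \<times> K))"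
    "{t \<in> S. hits (c t) V} \<subseteq> {t \<in> S. hits (c t) (core b)}"
proof -
  define G where "G s = \<Union>(supp ` snd ` c s)" for s
  obtain b where b: "b \<in> Fpow (Fpow (((\<Union>s\<in>S. G s) \<inter> I) \<times> K))" "large b"
      "\<forall>h. pre V \<subseteq> region h \<and> supp h \<subseteq> (\<Union>s\<in>S. G s) \<longrightarrow> pre (core b) \<subseteq> region h"
    by (rule reflection[OF assms(1,2), where J = "\<Union>s\<in>S. G s"])
  have bD: "finite b" "\<forall>a\<in>b. finite a" "\<Union>b \<subseteq> ((\<Union>s\<in>S. G s) \<inter> I) \<times> K"
    using b(1) unfolding Fpow_Fpow_iff by auto
  have sb: "supp b \<subseteq> (\<Union>s\<in>S. G s) \<inter> I" "snd ` \<Union>b \<subseteq> K"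
    using bD(3) unfolding supp_def subset_Times_iff by blast+
  have "\<forall>i\<in>supp b. \<exists>s. s \<in> S \<and> i \<in> G s" using sb(1) by blast
  then obtain s where s: "\<forall>i\<in>supp b. s i \<in> S \<and> i \<in> G (s i)" using bchoice by metis
  define F where "F = s ` supp b"
  have "finite (supp b)" using b(1) by (rule finite_supp)
  then have F: "finite F" "F \<subseteq> S" "supp b \<subseteq> (\<Union>s\<in>F. G s)" unfolding F_def using s by auto
  show thesis
  proof
    show "finite F" "F \<subseteq> S" "large b" by fact+
    have "\<Union>b \<subseteq> (\<Union>s\<in>F. G s) \<times> K"
      using sb(2) F(3) unfolding subset_Times_iff supp_def by (intro conjI)
    then show "b \<in> Fpow (Fpow ((\<Union>s\<in>F. \<Union>(supp ` snd ` c s)) \<times> K))"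
      using bD(1,2) unfolding G_def Fpow_Fpow_iff by blast
    show "{t \<in> S. hits (c t) V} \<subseteq> {t \<in> S. hits (c t) (core b)}"
    proof
      fix t assume "t \<in> {t \<in> S. hits (c t) V}"
      then obtain U g where t: "t \<in> S" "(U, g) \<in> c t" "pre V \<subseteq> region g" unfolding hits_def by blast
      have "supp g \<subseteq> G t" using t(2) unfolding G_def by force
      then have "supp g \<subseteq> (\<Union>s\<in>S. G s)" using t(1) by blast
      then have "pre (core b) \<subseteq> region g" using b(3) t(3) by blast
      then show "t \<in> {t \<in> S. hits (c t) (core b)}" using t(1,2) unfolding hits_def by blast
    qed
  qed
qed

text \<open>From some stage on, the code \<open>b\<close> reflecting \<open>V\<close> is among those
  avoided. The stages hit by \<open>V\<close> thus lie in a proper initial segment of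
  \<open>K\<close>, which has fewer than \<open>|K|\<close> elements.\<close>

lemma few_indices_weight_eq:
  assumes c: "\<And>t. t \<in> K \<Longrightarrow> cover_task \<B> (\<tau> t) (c t)"
    and avoid: "avoiding K (underS |K| ) c"
    and V: "openin X V" "V \<noteq> {}"
  shows "|{t \<in> K. hits (c t) V}| <o |K|"
proof -
  define G where "G s = \<Union>(supp ` snd ` c s)" for s
  let ?Q = "\<lambda>V. {t \<in> K. hits (c t) V}"
  obtain b F where b: "finite F" "F \<subseteq> K" "large b" "b \<in> Fpow (Fpow ((\<Union>s\<in>F. G s) \<times> K))"
      "?Q V \<subseteq> ?Q (core b)"
    unfolding G_def by (rule reflection_into_indices[OF V subset_refl c])
  \<comment> \<open>Stages and labels both range over \<open>K\<close>, so the labels in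
    \<open>b\<close> can be bounded by a stage together with \<open>F\<close>.\<close>
  define F' where "F' = F \<union> snd ` \<Union>b"
  have bD: "finite b" "\<forall>a\<in>b. finite a" "\<Union>b \<subseteq> (\<Union>s\<in>F. G s) \<times> K"
    using b(4) unfolding Fpow_Fpow_iff by auto
  have "finite (\<Union>b)" using bD(1,2) by blast
  then have F': "finite F'" "F' \<subseteq> K" using b(1,2) bD(3) unfolding F'_def by auto
  have "t \<notin> ?Q (core b)" if "t \<in> K" "F' \<subseteq> underS |K| t" for t
  proof -
    have "\<Union>b \<subseteq> (\<Union>s\<in>F. G s) \<times> snd ` \<Union>b"
      using bD(3) unfolding subset_Times_iff by simp
    also have "\<dots> \<subseteq> (\<Union>s\<in>underS |K| t. G s) \<times> underS |K| t"
      using that(2) unfolding F'_def by (intro Sigma_mono UN_mono) blast+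
    finally have "b \<in> Fpow (Fpow ((\<Union>s\<in>underS |K| t. G s) \<times> underS |K| t))"
      using bD(1,2) unfolding Fpow_Fpow_iff by blast
    then show ?thesis using avoid that(1) b(3) unfolding avoiding_def G_def by blast
  qed
  then have *: "t \<notin> ?Q V" if "t \<in> K" "F' \<subseteq> underS |K| t" for t using b(5) that by blast
  from F' show ?thesis
  proof (cases rule: finite_subset_underS_cases)
    case 1
    then have "?Q V = {}" using * by blast
    then show ?thesis using finite_card_less_infinite[OF _ infinite_K] by (metis finite.emptyI)
  next
    case (2 m)
    then have "?Q V \<subseteq> under |K| m" using * by blast
    then have "|?Q V| \<le>o |under |K| m|" by (rule card_of_mono1)
    also have "|under |K| m| <o |K|" by (rule card_under_less[OF infinite_K subsetD[OF F'(2) 2(1)]])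
    finally show ?thesis .
  qed
qed

text \<open>With all labels allowed, only \<open>F\<close> matters: the stages hit by
  \<open>V\<close> do not exceed the maximum \<open>m\<close> of \<open>F\<close>. Those before
  \<open>m\<close> are also hit by \<open>core b\<close>, and induction on \<open>m\<close> makes
  them finite.\<close>

lemma finitely_many_indices:
  assumes c: "\<And>t. t \<in> T \<Longrightarrow> cover_task \<B> (\<tau> t) (c t)"
    and avoid: "avoiding T (\<lambda>_. K) c"
    and V: "openin X V" "V \<noteq> {}"
  shows "finite {t \<in> T. hits (c t) V}"
proof -
  define G where "G s = \<Union>(supp ` snd ` c s)" for s
  define Q where "Q V S = {t \<in> S. hits (c t) V}" for V S
  have down: "finite (Q V S)"
    if V: "openin X V" "V \<noteq> {}" and S: "S \<subseteq> T"
      and fin: "\<And>m W. \<lbrakk>m \<in> S; openin X W; W \<noteq> {}\<rbrakk> \<Longrightarrow> finite (Q W (underS |T| m))" for V S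
  proof -
    obtain b F where b: "finite F" "F \<subseteq> S" "large b" "b \<in> Fpow (Fpow ((\<Union>s\<in>F. G s) \<times> K))"
        "Q V S \<subseteq> Q (core b) S"
      unfolding G_def Q_def by (rule reflection_into_indices[OF V S c])
    have *: "t \<notin> Q V S" if "t \<in> T" "F \<subseteq> underS |T| t" for t
    proof -
      have "Fpow (Fpow ((\<Union>s\<in>F. G s) \<times> K)) \<subseteq> Fpow (Fpow ((\<Union>s\<in>underS |T| t. G s) \<times> K))"
        using that(2) by (intro Fpow_mono) blast
      then have "b \<in> Fpow (Fpow ((\<Union>s\<in>underS |T| t. G s) \<times> K))" using b(4) by blast
      then have "t \<notin> Q (core b) S" using avoid that(1) b(3) unfolding avoiding_def G_def Q_def by blast
      then show ?thesis using b(5) by blast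
    qed
    have QT: "Q V S \<subseteq> T" using S unfolding Q_def by blast
    have "F \<subseteq> T" using b(2) S by blast
    with b(1) show ?thesis
    proof (cases rule: finite_subset_underS_cases)
      case 1
      then have "Q V S = {}" using * QT by blast
      then show ?thesis by simp
    next
      case (2 m)
      have "Q V S \<subseteq> under |T| m" using * QT 2(2) by blast
      then have "Q V S \<subseteq> insert m (Q (core b) (underS |T| m))"
        using b(5) unfolding Q_def under_def underS_def by blast
      moreover have "finite (Q (core b) (underS |T| m))"
        using fin 2(1) b(2) core[OF b(3)] by blast
      ultimately show ?thesis using finite_subset by blast
    qed
  qed
  have wf: "wf ( |T| - Id)" using card_of_well_order_on[of T] by (simp add: well_order_on_def)
  \<comment> \<open>The induction must quantify over all \<open>V\<close>, since \<open>V\<close> is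
    replaced by \<open>core b\<close> on the way down.\<close>
  have "\<forall>V. openin X V \<longrightarrow> V \<noteq> {} \<longrightarrow> finite (Q V (underS |T| m))" for m
  proof (induction m rule: wf_induct_rule[OF wf])
    case (1 m)
    show ?case
    proof (intro allI impI)
      fix V assume V: "openin X V" "V \<noteq> {}"
      have "underS |T| m \<subseteq> Field |T|" by (rule Order_Relation.underS_Field)
      then have "underS |T| m \<subseteq> T" by (simp only: Field_card_of)
      then show "finite (Q V (underS |T| m))"
      proof (rule down[OF V])
        fix m' W assume "m' \<in> underS |T| m" and W: "openin X W" "W \<noteq> {}"
        then have "(m', m) \<in> |T| - Id" unfolding underS_def by simp
        then show "finite (Q W (underS |T| m'))" using 1 W by simp
      qed
    qed
  qed
  then have "finite (Q V T)" by (intro down[OF V subset_refl]) simp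
  then show ?thesis unfolding Q_def .
qed

section \<open>Comparing the weight with the cardinal of \<open>K\<close>\<close>

lemma cover_tasks_exist:
  assumes A: "is_base X \<A>" and B: "is_base X \<B>" and u: "u \<in> \<A> \<times> \<A>"
  shows "\<exists>c. cover_task \<B> u c"
proof (cases "X closure_of fst u \<subseteq> snd u")
  case False
  then have "cover_task \<B> u {}" unfolding cover_task_def by auto
  then show ?thesis by blast
next
  case True
  have o: "openin X (fst u)" "openin X (snd u)" using u A unfolding is_base_def by auto
  then have "fst u \<subseteq> X closure_of fst u" by (simp add: closure_of_subset openin_subset)
  have "\<exists>\<F>. finite \<F> \<and> \<F> \<subseteq> {U \<in> \<B>. U \<subseteq> snd u} \<and> X closure_of fst u \<subseteq> \<Union>\<F>"
  proof (rule compactinD)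
    show "compactin X (X closure_of fst u)" by (rule closedin_compact_space[OF compact_X closedin_closure_of])
    show "openin X U" if "U \<in> {U \<in> \<B>. U \<subseteq> snd u}" for U
      using that B unfolding is_base_def by blast
    show "X closure_of fst u \<subseteq> \<Union>{U \<in> \<B>. U \<subseteq> snd u}"
      using True o(2) B unfolding is_base_def by blast
  qed
  then obtain \<F> where F: "finite \<F>" "\<F> \<subseteq> {U \<in> \<B>. U \<subseteq> snd u}" "X closure_of fst u \<subseteq> \<Union>\<F>" by blast
  \<comment> \<open>A code with one unconstrained box: the whole product encloses every preimage,
    which suffices where no core has to be avoided.\<close>
  have "region {{}} = topspace P" unfolding region_def box_def by simp
  then have "cover_task \<B> u ((\<lambda>U. (U, {{}})) ` \<F>)"
    unfolding cover_task_def using F \<open>fst u \<subseteq> X closure_of fst u\<close>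
    by (auto simp: image_image Fpow_def)
  then show ?thesis by blast
qed

lemma op_like_subfamily_base:
  assumes pw: "\<And>p. p \<in> topspace X \<Longrightarrow> pi_char_eq_weight X p"
    and A: "realizes_weight X \<A>" and B: "is_base X \<B>"
  shows "\<exists>\<C>\<subseteq>\<B>. is_base X \<C> \<and> op_like K \<C>"
proof -
  have bA: "is_base X \<A>" using A unfolding realizes_weight_def by blast
  consider "|\<A>| <o |K|" | "|\<A>| =o |K|" | "|K| <o |\<A>|"
    using ordLess_or_ordLeq[of "|\<A>|" "|K|"] card_of_Well_order ordLeq_iff_ordLess_or_ordIso ordIso_symmetric
    by metis
  then show ?thesis
  proof cases
    case 1
    obtain c where c: "\<And>t. t \<in> \<A> \<times> \<A> \<Longrightarrow> cover_task \<B> t (c t)"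
      using cover_tasks_exist[OF bA B] by metis
    \<comment> \<open>The pairs themselves serve as stages, and there are too few of them in total
      for any set to hit \<open>|K|\<close> many.\<close>
    have "|\<A> \<times> \<A>| <o |K|" using infinite_K 1 1 by (rule card_Times_less)
    then have "|{t \<in> \<A> \<times> \<A>. hits (c t) V}| <o |K|" for V
      by (rule ordLeq_ordLess_trans[OF card_of_mono1[OF Collect_restrict]])
    then have "op_like K ((\<Union>t\<in>\<A> \<times> \<A>. fst ` c t) - {{}})"
      using c by (intro op_like_if_few_indices[OF B infinite_K, where \<tau> = "\<lambda>t. t"])
    moreover have "\<A> \<times> \<A> \<subseteq> (\<lambda>t. t) ` (\<A> \<times> \<A>)" by simp
    note cover_tasks_base[OF bA B this c]
    ultimately show ?thesis by blast
  next
    case 2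
    then have "infinite \<A>" using infinite_K card_of_ordIso_finite by blast
    then have "|\<A> \<times> \<A>| \<le>o |K|" "\<A> \<times> \<A> \<noteq> {}"
      using 2 card_of_Times_same_infinite ordIso_transitive ordIso_iff_ordLeq by (blast, auto)
    then obtain \<tau> where \<tau>: "\<tau> ` K = \<A> \<times> \<A>" using card_of_ordLeq2 by metis
    \<comment> \<open>Limiting the labels at stage \<open>t\<close> to those before \<open>t\<close>
      keeps the number of codes below \<open>|K|\<close>, which is the weight here.\<close>
    have "\<exists>c. (\<forall>t\<in>K. cover_task \<B> (\<tau> t) (c t)) \<and> avoiding K (underS |K| ) c"
    proof (rule avoiding_sequence[OF pw A B infinite_K])
      show "|K| \<le>o |\<A>|" using 2 ordIso_iff_ordLeq by blast
      show "\<tau> t \<in> \<A> \<times> \<A>" if "t \<in> K" for t using \<tau> that by blast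
      show "|underS |K| t| <o |K|" if "t \<in> K" for t using that by (rule card_underS_less)
    qed
    then obtain c where c: "\<And>t. t \<in> K \<Longrightarrow> cover_task \<B> (\<tau> t) (c t)" "avoiding K (underS |K| ) c"
      by blast
    have "op_like K ((\<Union>t\<in>K. fst ` c t) - {{}})"
      using few_indices_weight_eq[OF c] by (intro op_like_if_few_indices[OF B infinite_K c(1)])
    moreover have "\<A> \<times> \<A> \<subseteq> \<tau> ` K" using \<tau> by simp
    note cover_tasks_base[OF bA B this c(1)]
    ultimately show ?thesis by blast
  next
    case 3
    then have "infinite \<A>"
      using infinite_K finite_card_less_infinite not_ordLess_ordLeq ordLess_imp_ordLeq by blast
    then have "|\<A> \<times> \<A>| \<le>o |\<A>|" "\<A> \<times> \<A> \<noteq> {}"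
      using card_of_Times_same_infinite ordIso_iff_ordLeq by (blast, auto)
    then obtain \<tau> where \<tau>: "\<tau> ` \<A> = \<A> \<times> \<A>" using card_of_ordLeq2 by metis
    \<comment> \<open>Now \<open>|K|\<close> is below the weight, so all labels may be allowed at
      every stage.\<close>
    have "\<exists>c. (\<forall>t\<in>\<A>. cover_task \<B> (\<tau> t) (c t)) \<and> avoiding \<A> (\<lambda>_. K) c"
    proof (rule avoiding_sequence[OF pw A B \<open>infinite \<A>\<close>])
      show "\<tau> t \<in> \<A> \<times> \<A>" if "t \<in> \<A>" for t using \<tau> that by blast
      show "|\<A>| \<le>o |\<A>|" by (rule card_of_mono1) simp
      show "|K| <o |\<A>|" by fact
    qed
    then obtain c where c: "\<And>t. t \<in> \<A> \<Longrightarrow> cover_task \<B> (\<tau> t) (c t)" "avoiding \<A> (\<lambda>_. K) c"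
      by blast
    have "op_like K ((\<Union>t\<in>\<A>. fst ` c t) - {{}})"
      using finite_card_less_infinite[OF finitely_many_indices[OF c] infinite_K]
      by (intro op_like_if_few_indices[OF B infinite_K c(1)])
    moreover have "\<A> \<times> \<A> \<subseteq> \<tau> ` \<A>" using \<tau> by simp
    note cover_tasks_base[OF bA B this c(1)]
    ultimately show ?thesis by blast
  qed
qed

end

theorem theorem3p29:
  fixes K :: "'k set"
    and Y :: "'i \<Rightarrow> 'b topology" and I :: "'i set"
    and X :: "'a topology" and f :: "('i \<Rightarrow> 'b) \<Rightarrow> 'a"
  assumes "infinite K"
    and "\<forall>i\<in>I. compact_space (Y i) \<and> Hausdorff_space (Y i) \<and> weight_le (Y i) K"
    and "Hausdorff_space X"
    and "continuous_map (product_topology Y I) X f"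
    and "f ` topspace (product_topology Y I) = topspace X"
    and "\<forall>p\<in>topspace X. pi_char_eq_weight X p"
  shows "\<forall>\<B>. is_base X \<B> \<longrightarrow> (\<exists>\<C>\<subseteq>\<B>. is_base X \<C> \<and> op_like K \<C>)"
\<comment> \<open>A point of \<open>X\<close> provides a base realizing the weight and makes all
  factors nonempty; their bases are then nonempty too and can be indexed by \<open>K\<close>, with
  repetitions.\<close>
proof (cases "topspace X = {}")
  case True
  then have "is_base X {}" unfolding is_base_def using openin_subset by blast
  moreover have "op_like K {}" unfolding op_like_def by blast
  ultimately show ?thesis by blast
next
  case False
  then obtain p where p: "p \<in> topspace X" by blast
  then obtain \<A> where A: "realizes_weight X \<A>" using assms(6) unfolding pi_char_eq_weight_def by blast
  have "\<exists>n. is_base (Y i) (n ` K)" if i: "i \<in> I" for i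
  proof -
    obtain \<D> where D: "is_base (Y i) \<D>" "|\<D>| \<le>o |K|"
      using assms(2) i unfolding weight_le_def by blast
    have "topspace (product_topology Y I) \<noteq> {}" using assms(5) p by auto
    then have "topspace (Y i) \<noteq> {}" using i by (auto simp: PiE_eq_empty_iff)
    then have "\<D> \<noteq> {}" using D(1) unfolding is_base_def by blast
    then obtain n where "n ` K = \<D>" using D(2) card_of_ordLeq2 by metis
    then show ?thesis using D(1) by blast
  qed
  then obtain N where "\<And>i. i \<in> I \<Longrightarrow> is_base (Y i) (N i ` K)" by metis
  then interpret compacta_image K I Y N X f
    using assms by unfold_locales auto
  show ?thesis using op_like_subfamily_base[OF _ A] assms(6) by blast
qed

end
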